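(* Let $G$ be a vertex-transitive distance-regular graph with diameter $d\geq 1$ and intersection numbers $p^h_{i,j}$. Then $$\dim_f(G)=\frac{|V(G)|}{|V(G)|-\max\{\sum_{i=1}^d p^h_{i,i} : h=1,\ldots,d\}}.$$
   Context: All graphs are finite, simple and connected. A graph $G$ with diameter $d$ is distance-regular if for all $0\leq h,i,j\leq d$ and all vertices $x,y$ with $d(x,y)=h$, the number $p^h_{i,j}=|\{z\in V(G): d(x,z)=i,\ d(y,z)=j\}|$ depends only on $h,i,j$; these are the intersection numbers. $G$ is vertex-transitive if its automorphism group acts transitively on $V(G)$. For vertices $x,y$, $R\{x,y\}$ is the set of vertices $z$ with $d(x,z)\neq d(y,z)$. A resolving function of $G$ is $f:V(G)\to[0,1]$ with $\sum_{z\in R\{x,y\}}f(z)\geq 1$ for all distinct $x,y$; $\dim_f(G)$ is the minimum of $\sum_{v\in V(G)}f(v)$ over all resolving functions $f$. *)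

theory Defs
  imports "Graph_Theory.Graph_Theory"
begin

text \<open>
  A finite simple graph is an instance of the locale \<^locale>\<open>graph\<close>: a finite, loop-free,
  symmetric digraph without parallel arcs, each edge being represented by two opposite arcs.
\<close>

text \<open>Only meaningful when \<open>v\<close> is reachable from \<open>u\<close>, as is always the case in a connected graph.\<close>

definition graph_dist :: "('a, 'b) pre_digraph \<Rightarrow> 'a \<Rightarrow> 'a \<Rightarrow> nat" where
  "graph_dist G u v = (LEAST n. \<exists>p. pre_digraph.awalk G u p v \<and> length p = n)"

text \<open>This is the library's shortest-path distance for unit arc weights, read as a natural number.\<close>

lemma (in wf_digraph) \<mu>_unit_eq_graph_dist:
  assumes "u \<rightarrow>\<^sup>* v"
  shows "\<mu> (\<lambda>_. 1) u v = ereal (real (graph_dist G u v))"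
proof -
  have cost: "awalk_cost (\<lambda>_. 1) p = real (length p)" for p
    by (induction p) auto
  let ?P = "\<lambda>n. \<exists>p. awalk u p v \<and> length p = n"
  from assms obtain q where "awalk u q v"
    by (auto simp: reachable_awalk)
  then have "?P (length q)"
    by blast
  then have "?P (graph_dist G u v)"
    unfolding graph_dist_def by (rule LeastI)
  then obtain p where p: "awalk u p v" "length p = graph_dist G u v"
    by blast
  have least: "graph_dist G u v \<le> length r" if "awalk u r v" for r
    unfolding graph_dist_def using that by (intro Least_le) blast
  show ?thesis
  proof (rule antisym)
    show "\<mu> (\<lambda>_. 1) u v \<le> ereal (real (graph_dist G u v))"
      using min_cost_le_walk_cost[OF p(1), of "\<lambda>_. 1"] p(2) by (simp add: cost)
    show "ereal (real (graph_dist G u v)) \<le> \<mu> (\<lambda>_. 1) u v"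
      unfolding \<mu>_def by (rule INF_greatest) (simp add: cost least)
  qed
qed

definition graph_diameter :: "('a, 'b) pre_digraph \<Rightarrow> nat" where
  "graph_diameter G = Max {graph_dist G u v | u v. u \<in> verts G \<and> v \<in> verts G}"

definition intersection_numbers ::
    "('a, 'b) pre_digraph \<Rightarrow> (nat \<Rightarrow> nat \<Rightarrow> nat \<Rightarrow> nat) \<Rightarrow> bool" where
  "intersection_numbers G p \<longleftrightarrow>
    (\<forall>h \<le> graph_diameter G. \<forall>i \<le> graph_diameter G. \<forall>j \<le> graph_diameter G.
      \<forall>x \<in> verts G. \<forall>y \<in> verts G. graph_dist G x y = h \<longrightarrow>
        card {z \<in> verts G. graph_dist G x z = i \<and> graph_dist G y z = j} = p h i j)"

definition distance_regular :: "('a, 'b) pre_digraph \<Rightarrow> bool" where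
  "distance_regular G \<longleftrightarrow> (\<exists>p. intersection_numbers G p)"

text \<open>
  The equation \<open>app_iso \<phi> G = G\<close> also forces the tail and head maps of the image graph to be
  those of \<open>G\<close>, so that \<open>\<phi>\<close> is an isomorphism from \<open>G\<close> onto \<open>G\<close> itself.
\<close>

definition automorphism ::
    "('a, 'b) pre_digraph \<Rightarrow> ('a, 'b, 'a, 'b) digraph_isomorphism \<Rightarrow> bool" where
  "automorphism G \<phi> \<longleftrightarrow> pre_digraph.digraph_isomorphism G \<phi> \<and> app_iso \<phi> G = G"

definition vertex_transitive :: "('a, 'b) pre_digraph \<Rightarrow> bool" where
  "vertex_transitive G \<longleftrightarrow>
    (\<forall>u \<in> verts G. \<forall>v \<in> verts G. \<exists>\<phi>. automorphism G \<phi> \<and> iso_verts \<phi> u = v)"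

definition resolving_set :: "('a, 'b) pre_digraph \<Rightarrow> 'a \<Rightarrow> 'a \<Rightarrow> 'a set" where
  "resolving_set G x y = {z \<in> verts G. graph_dist G x z \<noteq> graph_dist G y z}"

definition resolving_function :: "('a, 'b) pre_digraph \<Rightarrow> ('a \<Rightarrow> real) \<Rightarrow> bool" where
  "resolving_function G f \<longleftrightarrow>
    (\<forall>v \<in> verts G. f v \<in> {0..1}) \<and>
    (\<forall>x \<in> verts G. \<forall>y \<in> verts G. x \<noteq> y \<longrightarrow> (\<Sum>z \<in> resolving_set G x y. f z) \<ge> 1)"

text \<open>
  \<^const>\<open>Least\<close> denotes the attained minimum; unlike an infimum, it is unspecified if there is none.
\<close>

definition frac_metric_dim :: "('a, 'b) pre_digraph \<Rightarrow> real" where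
  "frac_metric_dim G =
    (LEAST s. \<exists>f. resolving_function G f \<and> s = (\<Sum>v \<in> verts G. f v))"

end

theory Submission
  imports Defs
begin

text \<open>
  In a distance-regular graph, \<open>R{x,y}\<close> has \<open>card V - (\<Sum>i = 1..d. p\<^sup>h\<^sub>i\<^sub>i)\<close> elements when
  \<open>d(x,y) = h \<ge> 1\<close>. Let \<open>r\<close> be the smallest of these sizes. The constant function \<open>1/r\<close> is
  resolving, of total weight \<open>card V / r\<close>. Conversely, let \<open>h\<close> attain the minimum and sum the
  inequalities \<open>f(R{x,y}) \<ge> 1\<close> over all pairs \<open>(x,y)\<close> at distance \<open>h\<close>: each vertex lies in
  the same number \<open>c\<close> of the sets \<open>R{x,y}\<close>, as \<open>c\<close> can be expressed by intersection numbers,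
  so double counting gives that \<open>f\<close> has total weight at least \<open>card V / r\<close>. This averaging
  over pairs replaces averaging over the automorphism group.
\<close>

section \<open>Distance in a connected graph\<close>

lemma (in wf_digraph) graph_dist_le_length:
  assumes "awalk u q v"
  shows "graph_dist G u v \<le> length q"
  unfolding graph_dist_def using assms by (intro Least_le) blast

lemma (in wf_digraph) shortest_awalk:
  assumes "u \<rightarrow>\<^sup>* v"
  obtains q where "awalk u q v" "length q = graph_dist G u v"
proof -
  let ?P = "\<lambda>n. \<exists>q. awalk u q v \<and> length q = n"
  from assms obtain q where "awalk u q v"
    by (auto simp: reachable_awalk)
  then have "?P (length q)"
    by blast
  then have "?P (graph_dist G u v)"
    unfolding graph_dist_def by (rule LeastI)
  then show ?thesis
    using that by blast
qed

lemma (in wf_digraph) graph_dist_self [simp]: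
  assumes "u \<in> verts G"
  shows "graph_dist G u u = 0"
  using graph_dist_le_length[of u "[]" u] assms by (simp add: awalk_Nil_iff)

lemma (in sym_digraph) reverse_awalk:
  assumes "awalk u q v"
  shows "\<exists>q'. awalk v q' u \<and> length q' = length q"
  using assms
proof (induction q arbitrary: u)
  case Nil
  then show ?case
    by (auto simp: awalk_Nil_iff)
next
  case (Cons e q)
  then have e: "e \<in> arcs G" "u = tail G e" "awalk (head G e) q v"
    by (auto simp: awalk_Cons_iff)
  with Cons.IH obtain q' where q': "awalk v q' (head G e)" "length q' = length q"
    by blast
  from e(1) sym_arcs obtain e' where e': "e' \<in> arcs G" "tail G e = head G e'" "head G e = tail G e'"
    unfolding symmetric_conv by blast
  then have "awalk (head G e) [e'] u"
    using arc_implies_awalk[OF e'(1)] e(2) by simp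
  then have "awalk v (q' @ [e']) u"
    by (rule awalk_appendI[OF q'(1)])
  with q'(2) show ?case
    by (intro exI[of _ "q' @ [e']"]) simp
qed

locale connected_graph = graph G for G :: "('a, 'b) pre_digraph" (structure) +
  assumes connected: "Digraph_Component.connected G"
begin

lemma verts_nonempty: "verts G \<noteq> {}"
  using connected unfolding connected_def strongly_connected_def by simp

text \<open>\<open>connected\<close> speaks of the symmetrised digraph; the arcs of \<open>G\<close>
  are already symmetric, so reachability is the same in both.\<close>

lemma reachable:
  assumes "u \<in> verts G" "v \<in> verts G"
  shows "u \<rightarrow>\<^sup>* v"
  using connected assms reachable_mk_symmetric_eq[OF sym_arcs]
  unfolding connected_def strongly_connected_def by simp

lemma graph_dist_eq_0_iff:
  assumes "u \<in> verts G" "v \<in> verts G"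
  shows "graph_dist G u v = 0 \<longleftrightarrow> u = v"
proof
  assume "graph_dist G u v = 0"
  with shortest_awalk[OF reachable[OF assms]] show "u = v"
    by (metis awalk_empty_ends length_0_conv)
qed (use assms in simp)

lemma graph_dist_le_commute:
  assumes "u \<in> verts G" "v \<in> verts G"
  shows "graph_dist G v u \<le> graph_dist G u v"
  using shortest_awalk[OF reachable[OF assms]] reverse_awalk graph_dist_le_length by metis

lemma graph_dist_commute:
  assumes "u \<in> verts G" "v \<in> verts G"
  shows "graph_dist G v u = graph_dist G u v"
  using assms by (intro antisym graph_dist_le_commute)

lemma finite_graph_dists: "finite {graph_dist G u v | u v. u \<in> verts G \<and> v \<in> verts G}"
  using finite_image_set2[of "\<lambda>u. u \<in> verts G" "\<lambda>v. v \<in> verts G" "graph_dist G"]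
  by simp

lemma graph_dist_le_diameter:
  assumes "u \<in> verts G" "v \<in> verts G"
  shows "graph_dist G u v \<le> graph_diameter G"
  unfolding graph_diameter_def by (rule Max_ge[OF finite_graph_dists]) (use assms in blast)

text \<open>The first \<open>h\<close> arcs of a shortest walk between two vertices at maximal
  distance end at distance \<open>h\<close>. So every \<open>p h i i\<close> with \<open>h\<close>
  and \<open>i\<close> up to the diameter counts vertices for an actual pair.\<close>

lemma graph_dist_attained:
  assumes "h \<le> graph_diameter G"
  obtains u v where "u \<in> verts G" "v \<in> verts G" "graph_dist G u v = h"
proof -
  have "graph_diameter G \<in> {graph_dist G u v | u v. u \<in> verts G \<and> v \<in> verts G}"
    unfolding graph_diameter_def using finite_graph_dists verts_nonempty
    by (intro Max_in) auto
  then obtain u v where uv: "u \<in> verts G" "v \<in> verts G" "graph_dist G u v = graph_diameter G"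
    by auto
  obtain q where q: "awalk u q v" "length q = graph_dist G u v"
    using shortest_awalk[OF reachable[OF uv(1,2)]] .
  define w where "w = awlast u (take h q)"
  have walks: "awalk u (take h q) w" "awalk w (drop h q) v"
    using q(1) awalk_append_iff[of u "take h q" "drop h q" v] by (simp_all add: w_def)
  then have w: "w \<in> verts G"
    using awalk_last_in_verts by blast
  obtain q' where q': "awalk u q' w" "length q' = graph_dist G u w"
    using shortest_awalk[OF reachable[OF uv(1) w]] .
  \<comment> \<open>A shorter walk from \<open>u\<close> to \<open>w\<close> would shorten the walk
    from \<open>u\<close> to \<open>v\<close>.\<close>
  have "graph_dist G u v \<le> length (q' @ drop h q)"
    using awalk_appendI[OF q'(1) walks(2)] by (rule graph_dist_le_length)
  moreover have "graph_dist G u w \<le> length (take h q)"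
    using walks(1) by (rule graph_dist_le_length)
  ultimately have "graph_dist G u w = h"
    using q(2) q'(2) uv(3) assms by simp
  with that uv(1) w show ?thesis
    by blast
qed

end

section \<open>Counting in a distance-regular graph\<close>

locale distance_regular_graph = connected_graph G for G :: "('a, 'b) pre_digraph" (structure) +
  fixes p :: "nat \<Rightarrow> nat \<Rightarrow> nat \<Rightarrow> nat"
  assumes intersection_numbers: "intersection_numbers G p"
begin

abbreviation "\<delta> \<equiv> graph_dist G"
abbreviation "d \<equiv> graph_diameter G"

lemma card_spheres_inter:
  assumes "x \<in> verts G" "y \<in> verts G" "i \<le> d" "j \<le> d"
  shows "card {z \<in> verts G. \<delta> x z = i \<and> \<delta> y z = j} = p (\<delta> x y) i j"
  using intersection_numbers assms graph_dist_le_diameter[OF assms(1,2)]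
  unfolding intersection_numbers_def by blast

text \<open>The vertices that fail to resolve \<open>x\<close> and \<open>y\<close> are sorted by
  their common distance \<open>i\<close> to both. The value \<open>i = 0\<close> would force
  \<open>x = y\<close>, so the sum starts at 1.\<close>

lemma card_resolving_set:
  assumes "x \<in> verts G" "y \<in> verts G" "x \<noteq> y"
  shows "card (resolving_set G x y) + (\<Sum>i = 1..d. p (\<delta> x y) i i) = card (verts G)"
proof -
  let ?S = "\<lambda>i. {z \<in> verts G. \<delta> x z = i \<and> \<delta> y z = i}"
  have "z \<in> (\<Union>i\<in>{1..d}. ?S i)" if "z \<in> verts G" "\<delta> x z = \<delta> y z" for z
  proof -
    have "\<delta> x z \<noteq> 0"
      using that assms graph_dist_eq_0_iff by metis
    with that assms show ?thesis
      using graph_dist_le_diameter[of y z] by (auto simp: Suc_le_eq)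
  qed
  then have "verts G = resolving_set G x y \<union> (\<Union>i\<in>{1..d}. ?S i)"
    unfolding resolving_set_def by blast
  moreover have "card (resolving_set G x y \<union> (\<Union>i\<in>{1..d}. ?S i)) =
      card (resolving_set G x y) + card (\<Union>i\<in>{1..d}. ?S i)"
    by (intro card_Un_disjoint) (auto simp: resolving_set_def)
  moreover have "card (\<Union>i\<in>{1..d}. ?S i) = (\<Sum>i = 1..d. card (?S i))"
    by (intro card_UN_disjoint) auto
  moreover have "(\<Sum>i = 1..d. card (?S i)) = (\<Sum>i = 1..d. p (\<delta> x y) i i)"
    using assms by (intro sum.cong) (auto simp: card_spheres_inter)
  ultimately show ?thesis
    by simp
qed

lemma card_resolving_set_pos:
  assumes "x \<in> verts G" "y \<in> verts G" "x \<noteq> y"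
  shows "card (resolving_set G x y) > 0"
proof -
  have "x \<in> resolving_set G x y"
    using assms graph_dist_eq_0_iff[of y x] by (auto simp: resolving_set_def)
  moreover have "finite (resolving_set G x y)"
    by (simp add: resolving_set_def)
  ultimately show ?thesis
    by (auto simp: card_gt_0_iff)
qed

text \<open>The constant \<open>c\<close> of the double count. For a fixed vertex \<open>z\<close>,
  the pairs \<open>(x, y)\<close> are sorted by \<open>i\<close>, the distance from \<open>z\<close>
  to \<open>x\<close>, and \<open>j\<close>, that from \<open>z\<close> to \<open>y\<close>;
  \<open>z\<close> resolves the pair iff \<open>j\<close> differs from \<open>i\<close>. The factor
  \<open>p 0 i i\<close> is the size of a sphere of radius \<open>i\<close>.\<close>

definition resolved_pairs :: "nat \<Rightarrow> nat" where
  "resolved_pairs h = (\<Sum>i\<le>d. p 0 i i * (\<Sum>j\<in>{..d} - {i}. p i h j))"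

lemma card_resolved_pairs:
  assumes z: "z \<in> verts G" and h: "h \<le> d"
  shows "card {(x, y). (x \<in> verts G \<and> y \<in> verts G \<and> \<delta> x y = h) \<and> z \<in> resolving_set G x y} =
    resolved_pairs h"
proof -
  let ?g = "\<lambda>i. \<Sum>j\<in>{..d} - {i}. p i h j"
  let ?Y = "\<lambda>x. {y \<in> verts G. \<delta> x y = h \<and> \<delta> x z \<noteq> \<delta> y z}"
  have Y: "card (?Y x) = ?g (\<delta> z x)" if x: "x \<in> verts G" for x
  proof -
    have "?Y x = (\<Union>j\<in>{..d} - {\<delta> z x}. {y \<in> verts G. \<delta> x y = h \<and> \<delta> z y = j})"
      using x z graph_dist_le_diameter[OF z] graph_dist_commute[OF z] by auto
    also have "card \<dots> = (\<Sum>j\<in>{..d} - {\<delta> z x}. card {y \<in> verts G. \<delta> x y = h \<and> \<delta> z y = j})"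
      by (intro card_UN_disjoint) auto
    also have "\<dots> = ?g (\<delta> z x)"
      using x z h graph_dist_commute[OF z x] by (intro sum.cong) (auto simp: card_spheres_inter)
    finally show ?thesis .
  qed
  have "{(x, y). (x \<in> verts G \<and> y \<in> verts G \<and> \<delta> x y = h) \<and> z \<in> resolving_set G x y} =
      Sigma (verts G) ?Y"
    using z by (auto simp: resolving_set_def)
  then have "card {(x, y). (x \<in> verts G \<and> y \<in> verts G \<and> \<delta> x y = h) \<and> z \<in> resolving_set G x y} =
      (\<Sum>x\<in>verts G. card (?Y x))"
    by simp
  also have "\<dots> = (\<Sum>x\<in>verts G. ?g (\<delta> z x))"
    by (intro sum.cong) (simp_all add: Y)
  also have "\<dots> = (\<Sum>i\<le>d. \<Sum>x\<in>{x \<in> verts G. \<delta> z x = i}. ?g (\<delta> z x))"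
    using graph_dist_le_diameter[OF z] by (intro sum.group[symmetric]) auto
  also have "\<dots> = (\<Sum>i\<le>d. card {x \<in> verts G. \<delta> z x = i} * ?g i)"
    by (intro sum.cong) simp_all
  also have "\<dots> = resolved_pairs h"
    \<comment> \<open>A sphere around \<open>z\<close> is the intersection of two spheres with the
      same centre \<open>z\<close>, hence the index 0.\<close>
    unfolding resolved_pairs_def using card_spheres_inter[OF z z, of i i for i] z
    by (intro sum.cong) simp_all
  finally show ?thesis .
qed

lemma sum_resolving_sets:
  fixes f :: "'a \<Rightarrow> real"
  assumes h: "h \<le> d"
  shows "(\<Sum>(x, y) | x \<in> verts G \<and> y \<in> verts G \<and> \<delta> x y = h. sum f (resolving_set G x y)) =
    real (resolved_pairs h) * sum f (verts G)"
proof -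
  let ?P = "{(x, y). x \<in> verts G \<and> y \<in> verts G \<and> \<delta> x y = h}"
  let ?R = "\<lambda>q. resolving_set G (fst q) (snd q)"
  have fin: "finite ?P"
    by (rule finite_subset[of _ "verts G \<times> verts G"]) auto
  have "(\<Sum>(x, y) | x \<in> verts G \<and> y \<in> verts G \<and> \<delta> x y = h. sum f (resolving_set G x y)) =
      (\<Sum>q\<in>?P. \<Sum>z | z \<in> verts G \<and> z \<in> ?R q. f z)"
    by (intro sum.cong refl) (auto simp: resolving_set_def intro!: sum.cong)
  \<comment> \<open>Exchange the sums: \<open>f z\<close> is counted once for each pair that
    \<open>z\<close> resolves.\<close>
  also have "\<dots> = (\<Sum>z\<in>verts G. \<Sum>q | q \<in> ?P \<and> z \<in> ?R q. f z)"
    using fin by (intro sum.swap_restrict) auto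
  also have "\<dots> = (\<Sum>z\<in>verts G. real (resolved_pairs h) * f z)"
  proof (intro sum.cong refl)
    fix z assume "z \<in> verts G"
    then have "card {q. q \<in> ?P \<and> z \<in> ?R q} = resolved_pairs h"
      using card_resolved_pairs[of z h] h by (simp add: case_prod_unfold)
    then show "(\<Sum>q | q \<in> ?P \<and> z \<in> ?R q. f z) = real (resolved_pairs h) * f z"
      by simp
  qed
  finally show ?thesis
    by (simp add: sum_distrib_left)
qed

section \<open>Lower bound and attained minimum\<close>

lemma resolving_function_sum_ge:
  assumes f: "resolving_function G f" and h: "1 \<le> h" "h \<le> d"
  shows "real (card (verts G)) / (real (card (verts G)) - real (\<Sum>i = 1..d. p h i i))
    \<le> sum f (verts G)"
proof -
  let ?P = "{(x, y). x \<in> verts G \<and> y \<in> verts G \<and> \<delta> x y = h}"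
  let ?n = "real (card (verts G))" and ?c = "real (resolved_pairs h)"
  define r where "r = ?n - real (\<Sum>i = 1..d. p h i i)"
  have P: "x \<noteq> y \<and> real (card (resolving_set G x y)) = r" if "(x, y) \<in> ?P" for x y
  proof -
    from that h(1) have xy: "x \<in> verts G" "y \<in> verts G" "\<delta> x y = h" "x \<noteq> y"
      by auto
    then show ?thesis
      using card_resolving_set[OF xy(1,2,4)] unfolding r_def xy(3) by linarith
  qed
  have fin: "finite ?P"
    by (rule finite_subset[of _ "verts G \<times> verts G"]) auto
  obtain u v where "(u, v) \<in> ?P"
    using graph_dist_attained[OF h(2)] by blast
  then have "r > 0" "card ?P > 0"
    using P[of u v] card_resolving_set_pos[of u v] fin by (auto simp: card_gt_0_iff)
  \<comment> \<open>The constant weight 1 turns the double count into a relation between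
    \<open>?c\<close> and \<open>r\<close>, so the formula for \<open>?c\<close> need not be
    evaluated.\<close>
  have "real (card ?P) * r = (\<Sum>(x, y)\<in>?P. \<Sum>z\<in>resolving_set G x y. 1)"
    using P by (auto simp: case_prod_unfold)
  also have "\<dots> = ?c * ?n"
    using sum_resolving_sets[OF h(2), of "\<lambda>_. 1"] by simp
  finally have size: "real (card ?P) * r = ?c * ?n" .
  have "real (card ?P) = (\<Sum>(x, y)\<in>?P. 1)"
    by (simp add: case_prod_unfold)
  also have "\<dots> \<le> (\<Sum>(x, y)\<in>?P. sum f (resolving_set G x y))"
    using f P by (intro sum_mono) (auto simp: resolving_function_def)
  also have "\<dots> = ?c * sum f (verts G)"
    by (rule sum_resolving_sets[OF h(2)])
  finally have "real (card ?P) * r \<le> ?c * sum f (verts G) * r"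
    using \<open>r > 0\<close> by simp
  then have "?c * ?n \<le> ?c * (sum f (verts G) * r)"
    using size by (simp add: mult.assoc)
  \<comment> \<open>Since \<open>?c * ?n\<close> equals a positive number, \<open>?c\<close> can be
    cancelled.\<close>
  moreover have "?c > 0"
    using size \<open>r > 0\<close> \<open>card ?P > 0\<close> by (cases "resolved_pairs h = 0") auto
  ultimately have "?n \<le> sum f (verts G) * r"
    by simp
  with \<open>r > 0\<close> show ?thesis
    unfolding r_def[symmetric] by (simp add: divide_le_eq)
qed

lemma frac_metric_dim_eq:
  assumes "d \<ge> 1"
  shows "frac_metric_dim G = real (card (verts G)) /
    (real (card (verts G)) - real (Max {(\<Sum>i = 1..d. p h i i) | h. h \<in> {1..d}}))"
proof -
  let ?n = "real (card (verts G))"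
  let ?M = "{(\<Sum>i = 1..d. p h i i) | h. h \<in> {1..d}}"
  define r where "r = ?n - real (Max ?M)"
  have M: "finite ?M" "?M \<noteq> {}"
    using assms by auto
  then obtain h where h: "1 \<le> h" "h \<le> d" "Max ?M = (\<Sum>i = 1..d. p h i i)"
    using Max_in[OF M] by auto
  obtain u v where uv: "u \<in> verts G" "v \<in> verts G" "\<delta> u v = h"
    using graph_dist_attained[OF h(2)] .
  then have "u \<noteq> v"
    using h(1) by auto
  have "real (card (resolving_set G u v)) = r"
    using card_resolving_set[OF uv(1,2) \<open>u \<noteq> v\<close>] unfolding r_def h(3) uv(3) by linarith
  \<comment> \<open>As the size of a nonempty set, \<open>r\<close> is at least 1, which keeps the
    constant function \<open>1 / r\<close> within \<open>[0,1]\<close>.\<close>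
  then have r: "r \<ge> 1"
    using card_resolving_set_pos[OF uv(1,2) \<open>u \<noteq> v\<close>] by linarith
  have r_le: "r \<le> real (card (resolving_set G x y))"
    if "x \<in> verts G" "y \<in> verts G" "x \<noteq> y" for x y
  proof -
    have "\<delta> x y \<in> {1..d}"
      using that graph_dist_eq_0_iff[of x y] graph_dist_le_diameter[of x y]
      by (simp add: Suc_le_eq)
    then have "(\<Sum>i = 1..d. p (\<delta> x y) i i) \<le> Max ?M"
      by (intro Max_ge[OF M(1)]) blast
    then show ?thesis
      using card_resolving_set[OF that] by (simp add: r_def)
  qed
  have "resolving_function G (\<lambda>_. 1 / r)"
    unfolding resolving_function_def using r r_le by (auto simp: le_divide_eq)
  moreover have "?n / r \<le> sum f (verts G)" if "resolving_function G f" for f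
    using resolving_function_sum_ge[OF that h(1,2)] h(3) by (simp add: r_def)
  \<comment> \<open>The constant \<open>1 / r\<close> has total weight \<open>?n / r\<close>, so the
    lower bound is attained and \<open>LEAST\<close> denotes it.\<close>
  ultimately have "frac_metric_dim G = ?n / r"
    unfolding frac_metric_dim_def by (intro Least_equality exI[of _ "\<lambda>_. 1 / r"]) auto
  then show ?thesis
    by (simp add: r_def)
qed

end

theorem theorem2p4:
  fixes G :: "('a, 'b) pre_digraph"
    and p :: "nat \<Rightarrow> nat \<Rightarrow> nat \<Rightarrow> nat"
    and d :: nat
  assumes "graph G"
    and "Digraph_Component.connected G"
    and "vertex_transitive G"
    and "distance_regular G"
    and "intersection_numbers G p"
    and "d = graph_diameter G"
    and "d \<ge> 1"
  shows "frac_metric_dim G =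
    real (card (verts G)) /
      (real (card (verts G)) - real (Max {(\<Sum>i = 1..d. p h i i) | h. h \<in> {1..d}}))"
proof -
  interpret graph G
    by (rule assms(1))
  interpret distance_regular_graph G p
    by unfold_locales (use assms in auto)
  show ?thesis
    using frac_metric_dim_eq assms(6,7) by simp
qed

end
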